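(* Let $s_1,\dots,s_n\in\mathcal{S}$ and let $X^{(n)}$ be the given basis with $n$ columns, the $j$th column being the vertical stack of $x(t_1,s_j),\dots,x(t_m,s_j)$, where $x(t,s)$ solves the parameterized dynamical system $x'=f(x,t,s)$, $x(0)=x_0$. For $s\in\mathcal{S}$, let $a_n^\ast$ be the minimizer of $\rho_n(a,s)$ over $a\in\mathbb{R}^n$ whose entries sum to one, with associated minimum function value $\rho_n^\ast=\rho_n(a_n^\ast,s)$. Let $s_{n+1}\in\mathcal{S}$, let $x_{n+1}$ be the vertical stack of $x(t_1,s_{n+1}),\dots,x(t_m,s_{n+1})$, and define the updated basis $X^{(n+1)}=[X^{(n)}\ \ x_{n+1}]$. Let $a_{n+1}^\ast$ be the minimizer of $\rho_{n+1}(a,s)$, the objective with the basis $X^{(n+1)}$, over $a\in\mathbb{R}^{n+1}$ whose entries sum to one, and let $\rho_{n+1}^\ast=\rho_{n+1}(a_{n+1}^\ast,s)$ be the minimum function value. Then there is an $0\leq\alpha\leq1$ such that $$\rho_{n+1}^\ast=\alpha\,\rho_n^\ast,$$ for all $s\in\mathcal{S}$.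
   Context: Setting. $\mathcal{S}\subset\mathbb{R}^d$ is the parameter space, $T>0$, and for each $s\in\mathcal{S}$, $x(t,s)\in\mathbb{R}^p$ is the solution on $[0,T]$ of $x'=f(x,t,s)$ (prime denotes $d/dt$) with initial condition $x(0)=x_0$ independent of $s$. The solution is assumed bounded for all $t\in[0,T]$, $s\in\mathcal{S}$; $f$ is $\mathbb{R}^p$-valued, Lipschitz continuous, and its Jacobian $\nabla_x f$ with respect to the states is nonsingular. Fix times $0\le t_1<\cdots<t_m\le T$, with $w_i^2$ the integration weight associated with time $t_i$. $\|\cdot\|$ is the Euclidean norm. For a basis of $N$ elements corresponding to parameters $s_1,\dots,s_N$, write $x_j(t)=x(t,s_j)$. Then $X_i^{(N)}\in\mathbb{R}^{p\times N}$ has $j$th column $x_j(t_i)$ (so $X^{(N)}$ is the vertical stack of $X_1^{(N)},\dots,X_m^{(N)}$), $F_i^{(N)}\in\mathbb{R}^{p\times N}$ has $j$th column $f(x_j(t_i),t_i,s_j)$, and for $a\in\mathbb{R}^N$, $s\in\mathcal{S}$, $$\rho_N(a,s)=\sum_{i=1}^m w_i^2\,\|F_i^{(N)}a-f(X_i^{(N)}a,t_i,s)\|^2 .$$ *)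

theory Defs
  imports "HOL-Analysis.Analysis"
begin

text \<open>
  The number of columns varies, so a \<open>p \<times> N\<close> matrix is a family of columns
  \<open>nat \<Rightarrow> real ^ 'p\<close> of which only those with index in \<open>{1..N}\<close> are used, and
  \<open>\<real>\<^sup>N\<close> is \<open>{1..N} \<rightarrow>\<^sub>E UNIV\<close>. Going from \<open>N\<close> to \<open>N + 1\<close> keeps the first \<open>N\<close>
  columns and appends the one with index \<open>N + 1\<close>.
\<close>

definition mat_vec :: "nat \<Rightarrow> (nat \<Rightarrow> real ^ 'p) \<Rightarrow> (nat \<Rightarrow> real) \<Rightarrow> real ^ 'p" where
  "mat_vec N A a = (\<Sum>j = 1..N. a j *\<^sub>R A j)"

definition X_mat ::
  "(real \<Rightarrow> real ^ 'd \<Rightarrow> real ^ 'p) \<Rightarrow> (nat \<Rightarrow> real) \<Rightarrow> (nat \<Rightarrow> real ^ 'd) \<Rightarrow> nat \<Rightarrow> nat \<Rightarrow> real ^ 'p" where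
  "X_mat x t \<sigma> i j = x (t i) (\<sigma> j)"

definition F_mat ::
  "(real ^ 'p \<Rightarrow> real \<Rightarrow> real ^ 'd \<Rightarrow> real ^ 'p) \<Rightarrow> (real \<Rightarrow> real ^ 'd \<Rightarrow> real ^ 'p) \<Rightarrow>
   (nat \<Rightarrow> real) \<Rightarrow> (nat \<Rightarrow> real ^ 'd) \<Rightarrow> nat \<Rightarrow> nat \<Rightarrow> real ^ 'p" where
  "F_mat f x t \<sigma> i j = f (x (t i) (\<sigma> j)) (t i) (\<sigma> j)"

definition rho ::
  "(real ^ 'p \<Rightarrow> real \<Rightarrow> real ^ 'd \<Rightarrow> real ^ 'p) \<Rightarrow> (real \<Rightarrow> real ^ 'd \<Rightarrow> real ^ 'p) \<Rightarrow>
   nat \<Rightarrow> (nat \<Rightarrow> real) \<Rightarrow> (nat \<Rightarrow> real) \<Rightarrow> (nat \<Rightarrow> real ^ 'd) \<Rightarrow>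
   nat \<Rightarrow> (nat \<Rightarrow> real) \<Rightarrow> real ^ 'd \<Rightarrow> real" where
  "rho f x m t w \<sigma> N a s =
     (\<Sum>i = 1..m. (w i)\<^sup>2 *
        (norm (mat_vec N (F_mat f x t \<sigma> i) a - f (mat_vec N (X_mat x t \<sigma> i) a) (t i) s))\<^sup>2)"

definition sum_one_vecs :: "nat \<Rightarrow> (nat \<Rightarrow> real) set" where
  "sum_one_vecs N = {a \<in> {1..N} \<rightarrow>\<^sub>E UNIV. (\<Sum>j = 1..N. a j) = 1}"

end

theory Submission
  imports Defs
begin

text \<open>Enlarging the basis can only lower the minimum: padding a feasible coefficient vector
  with a zero leaves its entries summing to one (\<open>sum_one_vecs_extend_zero\<close>) and its
  objective value unchanged (\<open>rho_extend_zero\<close>). So the old minimum value is attained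
  by a competitor in the larger problem. As both values are nonnegative (\<open>rho_nonneg\<close>),
  their ratio lies in [0, 1] and serves as \<alpha>; it is chosen separately for each
  \<open>s\<close>.\<close>

lemma mat_vec_extend_zero: "mat_vec (N + 1) A (a(N + 1 := 0)) = mat_vec N A a"
  by (simp add: mat_vec_def)

text \<open>The column families \<open>F_mat\<close> and \<open>X_mat\<close> do not depend on
  \<open>N\<close>, so the zero coefficient removes the new column both from the linear combination
  of derivatives and from the state at which \<open>f\<close> is evaluated.\<close>

lemma rho_extend_zero:
  "rho f x m t w \<sigma> (N + 1) (a(N + 1 := 0)) s = rho f x m t w \<sigma> N a s"
  unfolding rho_def mat_vec_extend_zero ..

text \<open>An extensional vector over \<open>{1..N}\<close> is \<open>undefined\<close> at
  \<open>N + 1\<close>, so the zero must be written there explicitly; beyond \<open>N + 1\<close>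
  the vector stays \<open>undefined\<close>, as membership requires.\<close>

lemma sum_one_vecs_extend_zero:
  assumes "a \<in> sum_one_vecs N"
  shows "a(N + 1 := 0) \<in> sum_one_vecs (N + 1)"
proof -
  have "a(N + 1 := 0) \<in> {1..N + 1} \<rightarrow>\<^sub>E UNIV"
    using assms by (auto simp: sum_one_vecs_def PiE_iff extensional_def)
  moreover have "(\<Sum>j = 1..N + 1. (a(N + 1 := 0)) j) = 1"
    using assms by (simp add: sum_one_vecs_def)
  ultimately show ?thesis
    by (simp add: sum_one_vecs_def)
qed

lemma rho_nonneg: "0 \<le> rho f x m t w \<sigma> N a s"
  by (simp add: rho_def sum_nonneg)

theorem theorem4p5:
  fixes S :: "(real ^ 'd) set" and T :: real
    and f :: "real ^ 'p \<Rightarrow> real \<Rightarrow> real ^ 'd \<Rightarrow> real ^ 'p"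
    and x :: "real \<Rightarrow> real ^ 'd \<Rightarrow> real ^ 'p" and x0 :: "real ^ 'p"
    and m n :: nat and t w :: "nat \<Rightarrow> real" and \<sigma> :: "nat \<Rightarrow> real ^ 'd"
  assumes T_pos: "0 < T"
    and f_lipschitz: "\<exists>L. L-lipschitz_on (UNIV \<times> {0..T} \<times> S) (\<lambda>(y, \<tau>, s). f y \<tau> s)"
    and f_differentiable: "\<And>y \<tau> s. \<tau> \<in> {0..T} \<Longrightarrow> s \<in> S \<Longrightarrow> (\<lambda>z. f z \<tau> s) differentiable (at y)"
    and f_jacobian: "\<And>y \<tau> s. \<tau> \<in> {0..T} \<Longrightarrow> s \<in> S \<Longrightarrow> invertible (jacobian (\<lambda>z. f z \<tau> s) (at y))"
    and x_ode: "\<And>\<tau> s. \<tau> \<in> {0..T} \<Longrightarrow> s \<in> S \<Longrightarrow>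
      ((\<lambda>r. x r s) has_vector_derivative f (x \<tau> s) \<tau> s) (at \<tau> within {0..T})"
    and x_init: "\<And>s. s \<in> S \<Longrightarrow> x 0 s = x0"
    and x_bounded: "bounded ((\<lambda>(\<tau>, s). x \<tau> s) ` ({0..T} \<times> S))"
    and times: "1 \<le> m" "0 \<le> t 1" "strict_mono_on {1..m} t" "t m \<le> T"
    and params: "1 \<le> n" "\<And>j. j \<in> {1..n + 1} \<Longrightarrow> \<sigma> j \<in> S"
  shows "\<forall>s\<in>S. \<forall>a_n a_n1.
    is_arg_min (\<lambda>a. rho f x m t w \<sigma> n a s) (\<lambda>a. a \<in> sum_one_vecs n) a_n \<longrightarrow>
    is_arg_min (\<lambda>a. rho f x m t w \<sigma> (n + 1) a s) (\<lambda>a. a \<in> sum_one_vecs (n + 1)) a_n1 \<longrightarrow>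
    (\<exists>\<alpha>. 0 \<le> \<alpha> \<and> \<alpha> \<le> 1 \<and>
      rho f x m t w \<sigma> (n + 1) a_n1 s = \<alpha> * rho f x m t w \<sigma> n a_n s)"
proof (intro ballI allI impI)
  fix s a_n a_n1
  let ?\<rho> = "rho f x m t w \<sigma> n a_n s" and ?\<rho>' = "rho f x m t w \<sigma> (n + 1) a_n1 s"
  assume "is_arg_min (\<lambda>a. rho f x m t w \<sigma> n a s) (\<lambda>a. a \<in> sum_one_vecs n) a_n"
  then have "a_n(n + 1 := 0) \<in> sum_one_vecs (n + 1)"
    by (intro sum_one_vecs_extend_zero) (simp add: is_arg_min_def)
  moreover assume "is_arg_min (\<lambda>a. rho f x m t w \<sigma> (n + 1) a s) (\<lambda>a. a \<in> sum_one_vecs (n + 1)) a_n1"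
  \<comment> \<open>The padded old minimizer is a competitor for \<open>a_n1\<close>.\<close>
  ultimately have "?\<rho>' \<le> rho f x m t w \<sigma> (n + 1) (a_n(n + 1 := 0)) s"
    unfolding is_arg_min_linorder by blast
  then have "?\<rho>' \<le> ?\<rho>"
    by (simp only: rho_extend_zero)
  moreover have "0 \<le> ?\<rho>'"
    by (rule rho_nonneg)
  \<comment> \<open>If \<open>?\<rho>\<close> is 0, the two bounds force \<open>?\<rho>'\<close> to
    be 0 as well; division by zero then makes the ratio 0 and the equation still holds.\<close>
  ultimately have "0 \<le> ?\<rho>' / ?\<rho> \<and> ?\<rho>' / ?\<rho> \<le> 1 \<and> ?\<rho>' = ?\<rho>' / ?\<rho> * ?\<rho>"
    by (auto simp: divide_le_eq_1)
  then show "\<exists>\<alpha>. 0 \<le> \<alpha> \<and> \<alpha> \<le> 1 \<and> ?\<rho>' = \<alpha> * ?\<rho>"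
    by blast
qed

end
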